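(* Let $P(\mathbf{x})=\sum_\alpha c_\alpha\mathbf{x}^\alpha\in\mathbb{Z}[x_1,\ldots,x_n]$ be a polynomial with no constant term in which every monomial contains a single variable. If $P$ is non-trivially partition regular on $\mathbb{N}$, then there exists a nonempty homogeneous set $I\subseteq\mathrm{supp}(P)$ consisting of maximal indexes such that $\sum_{\alpha\in I}c_\alpha=0$.
   Context: $\mathbb{N}$ is the set of positive integers. $P$ is non-trivially partition regular if for every finite partition $\mathbb{N}=C_1\cup\ldots\cup C_r$ there exist $j$ and $a_1,\ldots,a_n\in C_j$, not all equal, with $P(a_1,\ldots,a_n)=0$. Multi-indexes $\alpha\in\mathbb{N}_0^n$, $\mathbf{x}^\alpha=\prod_i x_i^{\alpha_i}$, $|\alpha|=\sum_i\alpha_i$; $\alpha<\beta$ means $\alpha_i\le\beta_i$ for all $i$ and $\alpha\ne\beta$. $\mathrm{supp}(P)=\{\alpha\mid c_\alpha\ne0\}$. An index $\alpha\in\mathrm{supp}(P)$ is maximal if there is no $\beta\in\mathrm{supp}(P)$ with $\alpha<\beta$. A set of multi-indexes is homogeneous if all its elements have the same length $|\alpha|$.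
   Formalization: The polynomial P is additionally assumed to be nonzero: for n ≥ 2 the zero polynomial is non-trivially partition regular but has empty support, so no nonempty I exists. *)

theory Defs
  imports "HOL-Library.Poly_Mapping" "HOL-Library.Disjoint_Sets"
begin

text \<open>
  The variables \<open>x\<^sub>1, \<dots>, x\<^sub>n\<close> are indexed by a finite type \<open>'n\<close>.  A multi-index is a
  function \<open>'n \<Rightarrow> nat\<close>, and \<open>\<alpha> < \<beta>\<close> on multi-indexes is the library's strict pointwise order
  on functions, i.e. \<open>\<alpha> i \<le> \<beta> i\<close> for all \<open>i\<close> and \<open>\<alpha> \<noteq> \<beta>\<close>.  A polynomial with integer
  coefficients is the finitely supported map \<open>\<alpha> \<mapsto> c\<^sub>\<alpha>\<close>; thus \<open>keys P\<close> is \<open>supp(P)\<close> and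
  \<open>lookup P \<alpha>\<close> is \<open>c\<^sub>\<alpha>\<close>.
\<close>

type_synonym 'n multi_index = "'n \<Rightarrow> nat"

type_synonym 'n int_mpoly = "'n multi_index \<Rightarrow>\<^sub>0 int"

abbreviation supp :: "'n int_mpoly \<Rightarrow> 'n multi_index set" where
  "supp P \<equiv> Poly_Mapping.keys P"

abbreviation coeff :: "'n int_mpoly \<Rightarrow> 'n multi_index \<Rightarrow> int" where
  "coeff P \<alpha> \<equiv> Poly_Mapping.lookup P \<alpha>"

definition eval_mpoly :: "'n::finite int_mpoly \<Rightarrow> ('n \<Rightarrow> int) \<Rightarrow> int" where
  "eval_mpoly P x = (\<Sum>\<alpha>\<in>supp P. coeff P \<alpha> * (\<Prod>i\<in>UNIV. x i ^ \<alpha> i))"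

definition index_length :: "'n::finite multi_index \<Rightarrow> nat" where
  "index_length \<alpha> = (\<Sum>i\<in>UNIV. \<alpha> i)"

definition maximal_index :: "'n int_mpoly \<Rightarrow> 'n multi_index \<Rightarrow> bool" where
  "maximal_index P \<alpha> \<longleftrightarrow> \<alpha> \<in> supp P \<and> \<not> (\<exists>\<beta>\<in>supp P. \<alpha> < \<beta>)"

definition homogeneous :: "'n::finite multi_index set \<Rightarrow> bool" where
  "homogeneous I \<longleftrightarrow> (\<forall>\<alpha>\<in>I. \<forall>\<beta>\<in>I. index_length \<alpha> = index_length \<beta>)"

definition no_constant_term :: "'n int_mpoly \<Rightarrow> bool" where
  "no_constant_term P \<longleftrightarrow> coeff P (\<lambda>_. 0) = 0"

definition single_variable_monomials :: "'n int_mpoly \<Rightarrow> bool" where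
  "single_variable_monomials P \<longleftrightarrow> (\<forall>\<alpha>\<in>supp P. \<exists>!i. \<alpha> i \<noteq> 0)"

text \<open>The set partitioned is \<open>{0<..}\<close>, the positive integers.\<close>

definition nontrivially_partition_regular :: "'n::finite int_mpoly \<Rightarrow> bool" where
  "nontrivially_partition_regular P \<longleftrightarrow>
     (\<forall>\<C> :: nat set set. finite \<C> \<and> partition_on {0<..} \<C> \<longrightarrow>
        (\<exists>C\<in>\<C>. \<exists>a :: 'n \<Rightarrow> nat. (\<forall>i. a i \<in> C) \<and> (\<exists>i j. a i \<noteq> a j) \<and>
           eval_mpoly P (\<lambda>i. int (a i)) = 0))"

end

theory Submission
  imports Defs Complex_Main
begin

text \<open>
  Colour \<open>a\<close> by the residues of \<open>\<lfloor>ln a / \<epsilon>\<rfloor>\<close> and \<open>\<lfloor>ln (ln a) / \<delta>\<rfloor>\<close> modulo suitable integers, and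
  give every small \<open>a\<close> a colour of its own.  For a nontrivial monochromatic zero \<open>a\<close> of \<open>P\<close> let \<open>A\<close>
  be the largest value of a monomial at \<open>a\<close>, and let \<open>I\<close> be the set of the indexes whose monomials
  exceed \<open>A / K\<close>, where \<open>K\<close> is a large constant.  As all the \<open>a\<^sub>i\<close> are large, the indexes in \<open>I\<close> are
  maximal.  The double logarithmic colour forces their degrees to agree, and then the logarithmic
  colour forces the corresponding monomials to be equal to \<open>A\<close> up to a factor close to \<open>1\<close>.  Hence
  \<open>0 = P(a) = A (\<Sum>\<alpha>\<in>I. c\<^sub>\<alpha>) + r\<close> with \<open>\<bar>r\<bar> < A\<close>, so the integer \<open>\<Sum>\<alpha>\<in>I. c\<^sub>\<alpha>\<close> is \<open>0\<close>.
\<close>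

section \<open>Finite colourings of the reals and of the positive integers\<close>

text \<open>Two floors \<open>\<lfloor>x / \<epsilon>\<rfloor>\<close> that are congruent modulo
  \<open>M\<close> and differ by less than \<open>M\<close> coincide. So equal colours exclude all
  distances from \<open>\<epsilon>\<close> up to \<open>B\<close>.\<close>

lemma finite_coloring_separating_scales:
  fixes \<epsilon> B :: real
  assumes "\<epsilon> > 0"
  obtains f :: "real \<Rightarrow> int"
  where "finite (range f)"
    and "\<And>x y. f x = f y \<Longrightarrow> \<bar>x - y\<bar> \<le> B \<Longrightarrow> \<bar>x - y\<bar> < \<epsilon>"
proof
  define M where "M = \<lceil>\<bar>B\<bar> / \<epsilon>\<rceil> + 1"
  define f where "f x = \<lfloor>x / \<epsilon>\<rfloor> mod M" for x
  have "\<bar>B\<bar> / \<epsilon> \<ge> 0"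
    using assms by simp
  then have M: "M > 0" "\<bar>B\<bar> / \<epsilon> + 1 \<le> M"
    unfolding M_def by linarith+
  have "range f \<subseteq> {0..<M}"
    using M by (auto simp: f_def)
  then show "finite (range f)"
    by (rule finite_subset) auto
  fix x y
  assume fxy: "f x = f y" and B: "\<bar>x - y\<bar> \<le> B"
  have "\<bar>x / \<epsilon> - y / \<epsilon>\<bar> = \<bar>x - y\<bar> / \<epsilon>"
    using assms by (simp add: diff_divide_distrib[symmetric])
  also have "\<dots> \<le> \<bar>B\<bar> / \<epsilon>"
    using B assms by (intro divide_right_mono) auto
  finally have "\<bar>\<lfloor>x / \<epsilon>\<rfloor> - \<lfloor>y / \<epsilon>\<rfloor>\<bar> < M"
    using M(2) by linarith
  moreover have "M dvd \<lfloor>x / \<epsilon>\<rfloor> - \<lfloor>y / \<epsilon>\<rfloor>"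
    using fxy by (simp add: f_def mod_eq_dvd_iff)
  ultimately have "\<lfloor>x / \<epsilon>\<rfloor> = \<lfloor>y / \<epsilon>\<rfloor>"
    using zdvd_not_zless[of "\<bar>\<lfloor>x / \<epsilon>\<rfloor> - \<lfloor>y / \<epsilon>\<rfloor>\<bar>" M] by fastforce
  then have "\<bar>x / \<epsilon> - y / \<epsilon>\<bar> < 1"
    by linarith
  then show "\<bar>x - y\<bar> < \<epsilon>"
    using assms by (simp add: diff_divide_distrib[symmetric])
qed

lemma monochromatic_nontrivial_zero:
  fixes P :: "'n::finite int_mpoly" and f :: "nat \<Rightarrow> 'c"
  assumes "nontrivially_partition_regular P" "finite (range f)"
  obtains a where "\<And>i. a i > 0" "\<And>i j. f (a i) = f (a j)" "\<exists>i j. a i \<noteq> a j"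
    "eval_mpoly P (\<lambda>i. int (a i)) = 0"
proof -
  \<comment> \<open>Only colours attained on the positive integers are used, since
    \<open>partition_on\<close> forbids empty classes.\<close>
  define \<C> where "\<C> = (\<lambda>c. {n. 0 < n \<and> f n = c}) ` (f ` {0<..})"
  have "finite \<C>"
    unfolding \<C>_def using assms(2) by (meson finite_imageI finite_subset image_mono subset_UNIV)
  moreover have "partition_on {0<..} \<C>"
    by (rule partition_onI) (auto simp: \<C>_def disjnt_def)
  ultimately have "\<exists>C\<in>\<C>. \<exists>a :: 'n \<Rightarrow> nat. (\<forall>i. a i \<in> C) \<and> (\<exists>i j. a i \<noteq> a j) \<and>
      eval_mpoly P (\<lambda>i. int (a i)) = 0"
    by (intro assms(1)[unfolded nontrivially_partition_regular_def, rule_format] conjI)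
  then obtain C a where C: "C \<in> \<C>" "\<forall>i. a i \<in> C" and a: "\<exists>i j. a i \<noteq> a j"
    "eval_mpoly P (\<lambda>i. int (a i)) = 0"
    by auto
  obtain c where "\<And>i. a i > 0 \<and> f (a i) = c"
    using C by (auto simp: \<C>_def)
  then show ?thesis
    using that[of a] a by metis
qed

section \<open>Estimates for monomials, logarithms and powers\<close>

lemma prod_power_single_variable:
  fixes x :: "'n::finite \<Rightarrow> 'a::comm_semiring_1"
  assumes "\<And>j. j \<noteq> i \<Longrightarrow> \<alpha> j = 0"
  shows "(\<Prod>j\<in>UNIV. x j ^ \<alpha> j) = x i ^ index_length \<alpha>"
proof -
  have "(\<Prod>j\<in>UNIV. x j ^ \<alpha> j) = (\<Prod>j\<in>{i}. x j ^ \<alpha> j)"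
    by (rule prod.mono_neutral_right) (auto simp: assms)
  moreover have "index_length \<alpha> = (\<Sum>j\<in>{i}. \<alpha> j)"
    unfolding index_length_def by (rule sum.mono_neutral_right) (auto simp: assms)
  ultimately show ?thesis
    by simp
qed

text \<open>Some exponent grows by at least one, which gains a factor above \<open>c\<close>; the
  other factors do not shrink because every \<open>x i\<close> is at least 1.\<close>

lemma times_prod_power_less:
  fixes x :: "'n::finite \<Rightarrow> real"
  assumes "\<alpha> < \<beta>" "\<And>i. x i > c" "c \<ge> 1"
  shows "c * (\<Prod>i\<in>UNIV. x i ^ \<alpha> i) < (\<Prod>i\<in>UNIV. x i ^ \<beta> i)"
proof -
  have le: "\<alpha> i \<le> \<beta> i" for i
    using assms(1) by (meson le_funD less_imp_le)
  obtain k where k: "\<alpha> k < \<beta> k"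
    using assms(1) by (metis le_funI less_le_not_le not_le)
  have x: "x i \<ge> 1" for i
    using assms(2)[of i] assms(3) by linarith
  then have pos: "x i > 0" for i
    using less_le_trans zero_less_one by blast
  have split: "(\<Prod>i\<in>UNIV. x i ^ \<gamma> i) = x k ^ \<gamma> k * (\<Prod>i\<in>UNIV-{k}. x i ^ \<gamma> i)" for \<gamma>
    by (rule prod.remove) auto
  have "c * x k ^ \<alpha> k < x k ^ Suc (\<alpha> k)"
    using assms(2) pos by simp
  also have "\<dots> \<le> x k ^ \<beta> k"
    using k x by (intro power_increasing) auto
  finally have "c * x k ^ \<alpha> k < x k ^ \<beta> k" .
  moreover have "(\<Prod>i\<in>UNIV-{k}. x i ^ \<alpha> i) \<le> (\<Prod>i\<in>UNIV-{k}. x i ^ \<beta> i)"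
    using x pos le by (intro prod_mono) (auto intro: power_increasing less_imp_le)
  moreover have "0 \<le> c * x k ^ \<alpha> k"
    using assms(3) pos[of k] by simp
  moreover have "(\<Prod>i\<in>UNIV-{k}. x i ^ \<alpha> i) > 0"
    using pos by (intro prod_pos) auto
  ultimately have "(c * x k ^ \<alpha> k) * (\<Prod>i\<in>UNIV-{k}. x i ^ \<alpha> i)
      < x k ^ \<beta> k * (\<Prod>i\<in>UNIV-{k}. x i ^ \<beta> i)"
    by (rule mult_less_le_imp_less)
  then show ?thesis
    by (simp add: split mult.assoc)
qed

text \<open>Here \<open>d\<close>, \<open>d'\<close> stand for degrees and \<open>L\<close>,
  \<open>L'\<close> for logarithms of variables. By \<open>near\<close>, \<open>L\<close> and
  \<open>L'\<close> agree up to the factor \<open>2 * D\<close>, so \<open>separated\<close> brings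
  \<open>L' / L\<close> below \<open>1 + 1 / (2 * D)\<close>. Then \<open>d' * L'\<close> is at most
  \<open>d' * L + L / 2\<close>, while \<open>d > d'\<close> would make \<open>d * L\<close> at
  least \<open>d' * L + L\<close>; the gap \<open>L / 2\<close> exceeds
  \<open>\<kappa>\<close>.\<close>

lemma multiplier_le:
  fixes L L' \<kappa> :: real and d d' D :: nat
  assumes L: "L > 2 * \<kappa>" "L' > 2 * \<kappa>" "\<kappa> \<ge> 0" and d: "0 < d" "d \<le> D" "0 < d'" "d' \<le> D"
    and near: "\<bar>d * L - d' * L'\<bar> \<le> \<kappa>"
    and separated: "\<bar>ln L - ln L'\<bar> \<le> ln (2 * D) \<Longrightarrow> \<bar>ln L - ln L'\<bar> < ln (1 + 1 / (2 * D))"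
  shows "d \<le> d'"
proof (rule ccontr)
  assume "\<not> d \<le> d'"
  have pos: "L > 0" "L' > 0" "D > 0"
    using L d by linarith+
  \<comment> \<open>Stated generically to serve both orders:
    \<open>l \<le> e * l \<le> D * l' + \<kappa> \<le> 2 * D * l'\<close>, as
    \<open>\<kappa> < l' \<le> D * l'\<close>.\<close>
  have bound: "ln l \<le> ln (2 * D) + ln l'"
    if "l > 0" "l' > \<kappa>" "l' > 0" "0 < e" "e' \<le> D" "e * l \<le> e' * l' + \<kappa>"
    for l l' :: real and e e' :: nat
  proof -
    have "1 * l \<le> e * l" "e' * l' \<le> D * l'" "1 * l' \<le> D * l'"
      using that pos by (simp_all add: mult_right_mono)
    then have "l \<le> 2 * D * l'"
      using that by linarith
    then have "ln l \<le> ln (2 * D * l')"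
      using \<open>l > 0\<close> by (rule ln_mono)
    also have "\<dots> = ln (2 * D) + ln l'"
      using that pos by (simp add: ln_mult_pos)
    finally show ?thesis .
  qed
  have "ln L \<le> ln (2 * D) + ln L'"
    by (rule bound[of L L' d d']) (use L d pos near in linarith)+
  moreover have "ln L' \<le> ln (2 * D) + ln L"
    by (rule bound[of L' L d' d]) (use L d pos near in linarith)+
  ultimately have "ln L' < ln (1 + 1 / (2 * D)) + ln L"
    using separated by linarith
  also have "\<dots> = ln ((1 + 1 / (2 * D)) * L)"
    by (rule ln_mult_pos[symmetric]) (use pos in \<open>simp_all add: add_pos_nonneg\<close>)
  finally have "L' < (1 + 1 / (2 * D)) * L"
    using pos by (simp add: add_pos_nonneg)
  then have "d' * L' \<le> d' * ((1 + 1 / (2 * D)) * L)"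
    by (simp add: mult_left_mono)
  also have "\<dots> = d' * L + (d' / D) * (L / 2)"
    using pos by (simp add: field_simps)
  also have "\<dots> \<le> d' * L + 1 * (L / 2)"
    using pos d by (intro add_left_mono mult_right_mono) simp_all
  finally have "d' * L' \<le> d' * L + L / 2"
    by simp
  moreover have "(real d' + 1) * L \<le> d * L"
    using \<open>\<not> d \<le> d'\<close> pos by (intro mult_right_mono) simp_all
  then have "d' * L + L \<le> d * L"
    by (simp add: distrib_right)
  ultimately show False
    using near L(1) by linarith
qed

text \<open>Write \<open>x ^ d\<close> as \<open>y ^ d * exp t\<close> with
  \<open>t = d * (ln x - ln y) \<ge> - 1 / K\<close> and use \<open>exp t \<ge> 1 + t\<close>. The
  last hypothesis supplies the other side of the absolute value.\<close>

lemma power_close_to_power: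
  fixes x y K :: real and d D :: nat
  assumes "x > 0" "y > 0" "d \<le> D" "D > 0" "K > 0" and "\<bar>ln x - ln y\<bar> < 1 / (D * K)"
    and "x ^ d \<le> y ^ d"
  shows "\<bar>x ^ d - y ^ d\<bar> \<le> y ^ d / K"
proof -
  have "d * (ln y - ln x) \<le> d * (1 / (D * K))"
    using assms by (intro mult_left_mono) auto
  also have "\<dots> \<le> D * (1 / (D * K))"
    using assms by (intro mult_right_mono) auto
  finally have *: "- 1 / K \<le> d * (ln x - ln y)"
    using assms by (simp add: algebra_simps)
  have "y ^ d * (1 - 1 / K) \<le> y ^ d * exp (- 1 / K)"
    using assms exp_ge_add_one_self[of "- 1 / K"] by (intro mult_left_mono) auto
  also have "\<dots> \<le> y ^ d * exp (d * (ln x - ln y))"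
    using * assms by (intro mult_left_mono) auto
  also have "\<dots> = x ^ d"
    using assms by (simp add: exp_of_nat_mult exp_diff power_divide)
  finally show ?thesis
    using assms by (simp add: algebra_simps)
qed

section \<open>Vanishing of the coefficient sum over the dominant monomials\<close>

theorem theorem3p10:
  fixes P :: "'n::finite int_mpoly"
  assumes "P \<noteq> 0"
    and "no_constant_term P"
    and "single_variable_monomials P"
    and "nontrivially_partition_regular P"
  shows "\<exists>I. I \<noteq> {} \<and> I \<subseteq> supp P \<and> homogeneous I \<and>
             (\<forall>\<alpha>\<in>I. maximal_index P \<alpha>) \<and> (\<Sum>\<alpha>\<in>I. coeff P \<alpha>) = 0"
proof -
  have fin: "finite (supp P)" and ne: "supp P \<noteq> {}"
    using assms(1) by auto
  obtain v where v: "\<And>\<alpha>. \<alpha> \<in> supp P \<Longrightarrow> \<alpha> (v \<alpha>) \<noteq> 0"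
      "\<And>\<alpha> j. \<alpha> \<in> supp P \<Longrightarrow> j \<noteq> v \<alpha> \<Longrightarrow> \<alpha> j = 0"
    using assms(3) unfolding single_variable_monomials_def by metis
  have len_pos: "0 < index_length \<alpha>" if "\<alpha> \<in> supp P" for \<alpha>
    using v(1)[OF that] by (auto simp: index_length_def intro!: Nat.gr0I)
  define D where "D = (\<Sum>\<alpha>\<in>supp P. index_length \<alpha>)"
  have len_le: "index_length \<alpha> \<le> D" if "\<alpha> \<in> supp P" for \<alpha>
    unfolding D_def using that fin by (intro member_le_sum) auto
  have D: "D > 0"
    using ne len_pos len_le by fastforce
  \<comment> \<open>Replacing each monomial by an approximation with error at most
    \<open>m \<mu> / K\<close> changes the value of \<open>P\<close> by at most
    \<open>S * (m \<mu> / K)\<close>; the factor 2 in \<open>K\<close> turns this into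
    \<open>m \<mu> / 2\<close>.\<close>
  define S where "S = (\<Sum>\<alpha>\<in>supp P. \<bar>coeff P \<alpha>\<bar>)"
  define K where "K = real_of_int (2 * S)"
  have "S > 0"
    unfolding S_def using fin ne by (intro sum_pos) (auto simp: in_keys_iff)
  then have K: "K \<ge> 2"
    by (simp add: K_def)
  \<comment> \<open>The square yields \<open>ln (a i) > 2 * ln K\<close>, as
    \<open>multiplier_le\<close> requires for \<open>\<kappa> = ln K\<close>.\<close>
  define N where "N = nat \<lceil>K ^ 2\<rceil>"

  have "1 / (D * K) > 0"
    using D K by simp
  then obtain f :: "real \<Rightarrow> int" where f: "finite (range f)"
    "\<And>x y. f x = f y \<Longrightarrow> \<bar>x - y\<bar> \<le> ln K \<Longrightarrow> \<bar>x - y\<bar> < 1 / (D * K)"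
    by (rule finite_coloring_separating_scales[where B = "ln K"]) (rule that)
  have "ln (1 + 1 / (2 * D)) > 0"
    using D by (intro ln_gt_zero) simp
  then obtain g :: "real \<Rightarrow> int" where g: "finite (range g)"
    "\<And>x y. g x = g y \<Longrightarrow> \<bar>x - y\<bar> \<le> ln (2 * D) \<Longrightarrow> \<bar>x - y\<bar> < ln (1 + 1 / (2 * D))"
    by (rule finite_coloring_separating_scales[where B = "ln (2 * D)"]) (rule that)
  \<comment> \<open>The first component is injective up to \<open>N\<close> and constant beyond, so
    a monochromatic solution that is not constant lies above \<open>N\<close>. The default values of
    \<open>ln\<close> at small \<open>n\<close> are therefore harmless.\<close>
  define h where "h n = (min n (Suc N), f (ln (real n)), g (ln (ln (real n))))" for n :: nat
  have "range h \<subseteq> {..Suc N} \<times> range f \<times> range g"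
    by (auto simp: h_def)
  then have "finite (range h)"
    by (rule finite_subset) (use f(1) g(1) in auto)
  then obtain a where a: "\<And>i. a i > 0" "\<And>i j. h (a i) = h (a j)" "\<exists>i j. a i \<noteq> a j"
    "eval_mpoly P (\<lambda>i. int (a i)) = 0"
    by (rule monochromatic_nontrivial_zero[OF assms(4)]) (rule that)
  have a_gt: "a i > N" for i
  proof (rule ccontr)
    assume "\<not> a i > N"
    then have "a j = a i" for j
      using a(2)[of i j] by (auto simp: h_def min_def split: if_splits)
    with a(3) show False
      by metis
  qed
  have large: "real (a i) > K ^ 2" for i
    using a_gt[of i] unfolding N_def by linarith
  have "K ^ 2 \<ge> K"
    using K by (simp add: power2_eq_square)
  then have large': "real (a i) > K" for i
    using large[of i] by linarith
  have ln_large: "ln (a i) > 2 * ln K" for i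
    using large[of i] K ln_less_cancel_iff[of "K ^ 2" "a i"] a(1)[of i] by (simp add: ln_realpow)

  define m where "m \<alpha> = (\<Prod>i\<in>UNIV. real (a i) ^ \<alpha> i)" for \<alpha>
  have m: "m \<alpha> = real (a (v \<alpha>)) ^ index_length \<alpha>" if "\<alpha> \<in> supp P" for \<alpha>
    unfolding m_def by (rule prod_power_single_variable) (rule v(2)[OF that])
  have m_pos: "m \<alpha> > 0" for \<alpha>
    unfolding m_def using a(1) by (intro prod_pos) auto
  have "Max (m ` supp P) \<in> m ` supp P"
    using fin ne by (intro Max_in) auto
  then obtain \<mu> where \<mu>: "\<mu> \<in> supp P" "m \<mu> = Max (m ` supp P)"
    by auto
  then have m_le: "m \<alpha> \<le> m \<mu>" if "\<alpha> \<in> supp P" for \<alpha>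
    using that fin by simp

  define I where "I = {\<alpha> \<in> supp P. m \<mu> < K * m \<alpha>}"
  have \<mu>_I: "\<mu> \<in> I"
    using \<mu> m_pos[of \<mu>] K by (simp add: I_def)
  have maximal: "maximal_index P \<alpha>" if "\<alpha> \<in> I" for \<alpha>
  proof -
    \<comment> \<open>All variables exceed \<open>K\<close>, so a larger index would have a monomial
      above \<open>K * m \<alpha>\<close>, hence above the maximum \<open>m \<mu>\<close>.\<close>
    have False if \<beta>: "\<beta> \<in> supp P" "\<alpha> < \<beta>" for \<beta>
    proof -
      have "K * m \<alpha> < m \<beta>"
        unfolding m_def using \<beta> large' K by (intro times_prod_power_less) auto
      then show False
        using m_le[OF \<beta>(1)] \<open>\<alpha> \<in> I\<close> by (simp add: I_def)
    qed
    then show ?thesis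
      using that by (auto simp: maximal_index_def I_def)
  qed
  have ln_m: "ln (m \<alpha>) = index_length \<alpha> * ln (a (v \<alpha>))" if "\<alpha> \<in> supp P" for \<alpha>
    using that a(1) by (simp add: m ln_realpow)
  have near: "\<bar>index_length \<alpha> * ln (a (v \<alpha>)) - index_length \<mu> * ln (a (v \<mu>))\<bar> \<le> ln K"
    if "\<alpha> \<in> I" for \<alpha>
  proof -
    have \<alpha>: "\<alpha> \<in> supp P"
      using that by (simp add: I_def)
    have "ln (m \<mu>) \<le> ln (K * m \<alpha>)"
      using that m_pos[of \<mu>] by (simp add: I_def)
    also have "\<dots> = ln K + ln (m \<alpha>)"
      using K m_pos[of \<alpha>] by (intro ln_mult_pos) auto
    finally have "ln (m \<mu>) \<le> ln K + ln (m \<alpha>)" .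
    moreover have "ln (m \<alpha>) \<le> ln (m \<mu>)"
      using m_le[OF \<alpha>] m_pos[of \<alpha>] by simp
    moreover have "ln K \<ge> 0"
      using K by simp
    ultimately show ?thesis
      unfolding ln_m[OF \<alpha>, symmetric] ln_m[OF \<mu>(1), symmetric] by linarith
  qed
  \<comment> \<open>The inequality is one-sided; applied in both orders, it gives equality of
    degrees on \<open>I\<close>.\<close>
  have len_mono: "index_length \<alpha> \<le> index_length \<beta>"
    if supp: "\<alpha> \<in> supp P" "\<beta> \<in> supp P"
      and near: "\<bar>index_length \<alpha> * ln (a (v \<alpha>)) - index_length \<beta> * ln (a (v \<beta>))\<bar> \<le> ln K"
    for \<alpha> \<beta>
  proof (rule multiplier_le[OF ln_large ln_large _ len_pos len_le len_pos len_le near])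
    show "ln K \<ge> 0"
      using K by simp
    have "g (ln (ln (a (v \<alpha>)))) = g (ln (ln (a (v \<beta>))))"
      using a(2)[of "v \<alpha>" "v \<beta>"] by (simp add: h_def)
    then show "\<bar>ln (ln (a (v \<alpha>))) - ln (ln (a (v \<beta>)))\<bar> < ln (1 + 1 / (2 * D))"
      if "\<bar>ln (ln (a (v \<alpha>))) - ln (ln (a (v \<beta>)))\<bar> \<le> ln (2 * D)"
      using that by (rule g(2))
  qed (rule supp)+
  have len: "index_length \<alpha> = index_length \<mu>" if "\<alpha> \<in> I" for \<alpha>
  proof (rule antisym)
    have \<alpha>: "\<alpha> \<in> supp P"
      using that by (simp add: I_def)
    show "index_length \<alpha> \<le> index_length \<mu>"
      by (rule len_mono[OF \<alpha> \<mu>(1) near[OF that]])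
    show "index_length \<mu> \<le> index_length \<alpha>"
      by (rule len_mono[OF \<mu>(1) \<alpha>]) (subst abs_minus_commute, rule near[OF that])
  qed
  have close: "\<bar>m \<alpha> - m \<mu>\<bar> \<le> m \<mu> / K" if "\<alpha> \<in> I" for \<alpha>
  proof -
    have \<alpha>: "\<alpha> \<in> supp P"
      using that by (simp add: I_def)
    let ?d = "index_length \<mu>" and ?x = "real (a (v \<alpha>))" and ?y = "real (a (v \<mu>))"
    have "?d * \<bar>ln ?x - ln ?y\<bar> \<le> ln K"
      using near[OF that] len[OF that] by (simp add: right_diff_distrib[symmetric] abs_mult)
    \<comment> \<open>The common degree is at least 1, so the bound \<open>ln K\<close> passes from
      the monomials to the variables, within the range that \<open>f\<close> controls.\<close>
    moreover have "1 * \<bar>ln ?x - ln ?y\<bar> \<le> ?d * \<bar>ln ?x - ln ?y\<bar>"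
      using len_pos[OF \<mu>(1)] by (intro mult_right_mono) auto
    ultimately have "\<bar>ln ?x - ln ?y\<bar> \<le> ln K"
      by simp
    moreover have "f (ln ?x) = f (ln ?y)"
      using a(2)[of "v \<alpha>" "v \<mu>"] by (simp add: h_def)
    ultimately have ln_close: "\<bar>ln ?x - ln ?y\<bar> < 1 / (D * K)"
      by (rule f(2)[rotated])
    have le: "?x ^ ?d \<le> ?y ^ ?d"
      using m_le[OF \<alpha>] len[OF that] by (simp add: m \<alpha> \<mu>(1))
    have "\<bar>?x ^ ?d - ?y ^ ?d\<bar> \<le> ?y ^ ?d / K"
      by (rule power_close_to_power[OF _ _ len_le[OF \<mu>(1)] D _ ln_close le]) (use a(1) K in simp_all)
    then show ?thesis
      using len[OF that] by (simp add: m \<alpha> \<mu>(1))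
  qed
  \<comment> \<open>Outside \<open>I\<close> this is the failure of the inequality defining
    \<open>I\<close>.\<close>
  have approx: "\<bar>m \<alpha> - (if \<alpha> \<in> I then m \<mu> else 0)\<bar> \<le> m \<mu> / K" if "\<alpha> \<in> supp P" for \<alpha>
    using close that m_pos[of \<alpha>] K by (auto simp: I_def field_simps)

  have "(\<Sum>\<alpha>\<in>supp P. coeff P \<alpha> * m \<alpha>) = of_int (eval_mpoly P (\<lambda>i. int (a i)))"
    by (simp add: eval_mpoly_def m_def)
  then have zero: "(\<Sum>\<alpha>\<in>supp P. coeff P \<alpha> * m \<alpha>) = 0"
    using a(4) by simp
  \<comment> \<open>Because of \<open>zero\<close>, this product equals, up to sign, the total error
    of the approximations in \<open>approx\<close>.\<close>
  have "real_of_int (\<Sum>\<alpha>\<in>I. coeff P \<alpha>) * m \<mu> = (\<Sum>\<alpha>\<in>I. coeff P \<alpha> * m \<mu>)"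
    by (simp add: sum_distrib_right)
  also have "\<dots> = (\<Sum>\<alpha>\<in>supp P. coeff P \<alpha> * (if \<alpha> \<in> I then m \<mu> else 0))"
    by (rule sum.mono_neutral_cong_left) (auto simp: fin I_def)
  finally have "\<bar>real_of_int (\<Sum>\<alpha>\<in>I. coeff P \<alpha>) * m \<mu>\<bar>
      = \<bar>\<Sum>\<alpha>\<in>supp P. coeff P \<alpha> * (m \<alpha> - (if \<alpha> \<in> I then m \<mu> else 0))\<bar>"
    using zero by (simp add: right_diff_distrib sum_subtractf)
  also have "\<dots> \<le> (\<Sum>\<alpha>\<in>supp P. \<bar>coeff P \<alpha> * (m \<alpha> - (if \<alpha> \<in> I then m \<mu> else 0))\<bar>)"
    by (rule sum_abs)
  also have "\<dots> \<le> (\<Sum>\<alpha>\<in>supp P. \<bar>coeff P \<alpha>\<bar> * (m \<mu> / K))"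
    unfolding abs_mult of_int_abs by (intro sum_mono mult_left_mono approx abs_ge_zero)
  also have "\<dots> = real_of_int S * (m \<mu> / K)"
    by (simp only: S_def of_int_sum sum_distrib_right)
  also have "\<dots> = m \<mu> / 2"
    using \<open>S > 0\<close> by (simp add: K_def)
  finally have "\<bar>real_of_int (\<Sum>\<alpha>\<in>I. coeff P \<alpha>)\<bar> * m \<mu> \<le> 1 / 2 * m \<mu>"
    using m_pos[of \<mu>] by (simp add: abs_mult)
  then have "\<bar>real_of_int (\<Sum>\<alpha>\<in>I. coeff P \<alpha>)\<bar> \<le> 1 / 2"
    using m_pos[of \<mu>] by (simp only: mult_le_cancel_right_pos)
  \<comment> \<open>The sum is an integer, and 0 is the only integer of absolute value at most
    1/2.\<close>
  then have "(\<Sum>\<alpha>\<in>I. coeff P \<alpha>) = 0"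
    by linarith
  moreover have "homogeneous I"
    unfolding homogeneous_def by (metis len)
  moreover have "I \<subseteq> supp P"
    by (auto simp: I_def)
  ultimately show ?thesis
    using \<mu>_I maximal by blast
qed

end
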